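(* For every centered log-concave probability measure $\mu$ on $\mathbb{R}^n$, $$\|\Lambda_\mu^{\ast}\|_{L^{\psi_1}(\mu)}\le r_0:=\frac{32}{\ln 2}\,n\,t_n,\qquad t_n:=n\ln n,$$ where $r_0\approx n^2\ln n$. That is, $\|\Lambda_\mu^{\ast}\|_{L^{\psi_1}(\mu)}\le C\,n^2\ln n$ for an absolute constant $C>0$.
   Context: A Borel probability measure $\mu$ on $\mathbb{R}^n$ is called log-concave if $\mu(H)<1$ for every hyperplane $H$ of $\mathbb{R}^n$ and $\mu(\lambda A+(1-\lambda)B)\ge \mu(A)^{\lambda}\mu(B)^{1-\lambda}$ for all compact sets $A,B\subset\mathbb{R}^n$ and all $\lambda\in(0,1)$. It is centered if its barycenter is the origin. The log-Laplace transform is $\Lambda_\mu(\xi)=\ln\left(\int_{\mathbb{R}^n}e^{\langle\xi,z\rangle}\,d\mu(z)\right)$ and the Cramér transform of $\mu$ is $\Lambda_\mu^\ast(x)=\sup_{\xi\in\mathbb{R}^n}\{\langle x,\xi\rangle-\Lambda_\mu(\xi)\}$. The Orlicz norm corresponding to $\psi_1(t)=e^t-1$ is $\|\Lambda_\mu^\ast\|_{L^{\psi_1}(\mu)}=\inf\left\{r>0:\int_{\mathbb{R}^n}\exp(\Lambda_\mu^\ast(x)/r)\,d\mu(x)\le 2\right\}$. Here $a\approx b$ means that $c_1a\le b\le c_2a$ for some absolute constants $c_1,c_2>0$. "Absolute constant" means a constant independent of $n$ and $\mu$.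
   Formalization: The formal statement assumes n ≥ 2: for n = 1 one has r_0 = 0 and n^2 ln n = 0, while the norm is strictly positive for every centered log-concave measure on R (e.g. uniform on [-1,1]), so the claim is false there. *)

theory Defs
  imports "HOL-Probability.Probability"
begin

definition log_concave_measure :: "'a::euclidean_space measure \<Rightarrow> bool" where
  "log_concave_measure M \<longleftrightarrow>
     prob_space M \<and> sets M = sets borel \<and>
     (\<forall>a b. a \<noteq> 0 \<longrightarrow> measure M {x. a \<bullet> x = b} < 1) \<and>
     (\<forall>A B t. compact A \<longrightarrow> compact B \<longrightarrow> 0 < t \<longrightarrow> t < 1 \<longrightarrow>
        measure M A powr t * measure M B powr (1 - t)
          \<le> measure M {t *\<^sub>R a + (1 - t) *\<^sub>R b | a b. a \<in> A \<and> b \<in> B})"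

(* Integrability is stated because the Bochner integral of a non-integrable function is 0. *)
definition centered :: "'a::euclidean_space measure \<Rightarrow> bool" where
  "centered M \<longleftrightarrow> integrable M (\<lambda>x. x) \<and> (\<integral>x. x \<partial>M) = 0"

definition ln_ennreal :: "ennreal \<Rightarrow> ereal" where
  "ln_ennreal x =
     (if x = 0 then -\<infinity> else if x = \<infinity> then \<infinity> else ereal (ln (enn2real x)))"

definition exp_ereal :: "ereal \<Rightarrow> ennreal" where
  "exp_ereal x =
     (if x = -\<infinity> then 0 else if x = \<infinity> then \<infinity> else ennreal (exp (real_of_ereal x)))"

(* Both transforms take values in the extended reals: the log-Laplace transform may be infinite
   for large arguments, and the Cramer transform is infinite outside the closed convex hull of the
   support. *)
definition log_laplace :: "'a::euclidean_space measure \<Rightarrow> 'a \<Rightarrow> ereal" where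
  "log_laplace M \<xi> = ln_ennreal (\<integral>\<^sup>+ z. ennreal (exp (\<xi> \<bullet> z)) \<partial>M)"

definition cramer :: "'a::euclidean_space measure \<Rightarrow> 'a \<Rightarrow> ereal" where
  "cramer M x = (SUP \<xi>. ereal (x \<bullet> \<xi>) - log_laplace M \<xi>)"

(* The infimum is taken in the extended reals, so it is infinite if no r is admissible.
   No absolute value is needed: the Cramer transform of a probability measure is
   nonnegative. *)
definition cramer_psi1_norm :: "'a::euclidean_space measure \<Rightarrow> ereal" where
  "cramer_psi1_norm M =
     Inf {ereal r | r. 0 < r \<and> (\<integral>\<^sup>+ x. exp_ereal (cramer M x / ereal r) \<partial>M) \<le> 2}"

definition t_dim :: "nat \<Rightarrow> real" where
  "t_dim n = real n * ln (real n)"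

definition r0_dim :: "nat \<Rightarrow> real" where
  "r0_dim n = 32 / ln 2 * real n * t_dim n"

end

theory Submission
  imports Defs
begin

text \<open>
  Let \<open>\<mu>\<close> be the measure and \<open>n\<close> the dimension. For \<open>\<rho> > 0\<close> the function
  \<open>f x = \<mu> (cball x \<rho>)\<close> inherits log-concavity directly from the inequality for compact sets, so up to
  a constant it is a log-concave density of \<open>\<mu>\<close> smoothed at scale \<open>\<rho>\<close>, and no structure theorem for
  log-concave measures is needed. Let \<open>m\<close> bound \<open>f\<close>, attained up to a factor 2, and let \<open>b\<close> be the
  barycentre of \<open>f\<close> restricted to \<open>K = {f \<ge> m exp (- v)}\<close> with \<open>v\<close> of order \<open>n\<close>. If
  \<open>f y \<ge> m exp (- u)\<close> and \<open>x = (1 - \<epsilon>) y + \<epsilon> b\<close>, then substituting \<open>(1 - \<epsilon>) y + \<epsilon> w\<close> with \<open>w \<in> K\<close> in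
  the Laplace transform and using log-concavity and Jensen's inequality gives that the Cramer
  transform at \<open>x\<close> is at most \<open>n ln (1/\<epsilon>) + u + O(1)\<close>, up to an error that vanishes with \<open>\<rho>\<close>.
  Log-concavity also shows that such points \<open>x\<close> carry all but \<open>O(n \<epsilon>) + 2^(n+1) exp (- u/2)\<close> of the
  mass. With \<open>\<epsilon> = exp (- s)\<close>, \<open>u = 2 s + O(n)\<close> and \<open>\<rho> \<rightarrow> 0\<close>, the Cramer transform exceeds
  \<open>2 n s + 4 n\<close> with probability at most \<open>6 n exp (- s)\<close>, which yields the exponential moment.
\<close>

subsection \<open>Log-concave functions\<close>

text \<open>Written with powers instead of \<open>ln\<close>, so that zeros are allowed:
  \<open>0 powr t = 0\<close>, and a pair with a zero value constrains nothing beyond nonnegativity.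
  The shape is that of the inequality for compact sets.\<close>

definition log_concave_fun :: "('a::euclidean_space \<Rightarrow> real) \<Rightarrow> bool" where
  "log_concave_fun f \<longleftrightarrow> (\<forall>x. 0 \<le> f x) \<and>
     (\<forall>x y t. 0 < t \<longrightarrow> t < 1 \<longrightarrow>
        f x powr t * f y powr (1 - t) \<le> f (t *\<^sub>R x + (1 - t) *\<^sub>R y))"

lemma log_concave_funD:
  assumes "log_concave_fun f" "0 < t" "t < 1"
  shows "f x powr t * f y powr (1 - t) \<le> f (t *\<^sub>R x + (1 - t) *\<^sub>R y)"
  using assms unfolding log_concave_fun_def by blast

lemma log_concave_fun_nonneg: "log_concave_fun f \<Longrightarrow> 0 \<le> f x"
  unfolding log_concave_fun_def by blast

lemma convex_superlevel_log_concave: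
  assumes f: "log_concave_fun f" and c: "0 < c"
  shows "convex {x. c \<le> f x}"
proof (rule convexI)
  fix x y :: 'a and u v :: real
  assume x: "x \<in> {x. c \<le> f x}" and y: "y \<in> {x. c \<le> f x}"
    and uv: "0 \<le> u" "0 \<le> v" "u + v = 1"
  show "u *\<^sub>R x + v *\<^sub>R y \<in> {x. c \<le> f x}"
  proof (cases "0 < u \<and> 0 < v")
    case True
    have v: "v = 1 - u" using uv by simp
    have "c = c powr u * c powr (1 - u)"
      using c by (simp flip: powr_add)
    also have "\<dots> \<le> f x powr u * f y powr (1 - u)"
      using x y c True v by (intro mult_mono powr_mono2) auto
    also have "\<dots> \<le> f (u *\<^sub>R x + v *\<^sub>R y)"
      unfolding v using True v by (intro log_concave_funD[OF f]) auto
    finally show ?thesis by simp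
  next
    case False
    then have "u = 0 \<and> v = 1 \<or> u = 1 \<and> v = 0" using uv by auto
    then show ?thesis using x y by auto
  qed
qed

section \<open>Integral estimates: affine substitution, barycentres and log-concavity\<close>

lemma nn_integral_lborel_affine:
  fixes t :: "'a::euclidean_space" and g :: "'a \<Rightarrow> ennreal"
  assumes c: "0 < c" and [measurable]: "g \<in> borel_measurable borel"
  shows "(\<integral>\<^sup>+x. g x \<partial>lborel) = ennreal (c ^ DIM('a)) * (\<integral>\<^sup>+x. g (t + c *\<^sub>R x) \<partial>lborel)"
proof -
  have "(\<integral>\<^sup>+x. g x \<partial>lborel)
      = (\<integral>\<^sup>+x. g x \<partial>density (distr lborel borel (\<lambda>x. t + c *\<^sub>R x)) (\<lambda>_. \<bar>c\<bar>^DIM('a)))"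
    using c by (subst lborel_affine[of c t]) auto
  also have "\<dots> = ennreal (c ^ DIM('a)) * (\<integral>\<^sup>+x. g (t + c *\<^sub>R x) \<partial>lborel)"
    using c by (simp add: nn_integral_density nn_integral_distr nn_integral_cmult)
  finally show ?thesis .
qed

text \<open>A point strictly separated from \<open>K\<close> cannot be the mean of a measure living
  on \<open>K\<close>, and the second claim is Jensen's inequality for \<open>exp\<close>. The same
  \<open>b\<close> serves all \<open>\<zeta>\<close>.\<close>

lemma exp_barycentre_le:
  fixes M :: "'a::euclidean_space measure"
  assumes "prob_space M" and sets_M: "sets M = sets borel" and K: "compact K" "convex K" and AE: "AE x in M. x \<in> K"
  obtains b where "b \<in> K"
    and "\<And>\<zeta>. ennreal (exp (\<zeta> \<bullet> b)) \<le> (\<integral>\<^sup>+w. ennreal (exp (\<zeta> \<bullet> w)) \<partial>M)"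
proof -
  interpret prob_space M by fact
  have [measurable_cong]: "sets M = sets borel" by (fact sets_M)
  obtain B where B: "\<And>x. x \<in> K \<Longrightarrow> norm x \<le> B"
    using K(1) by (meson bounded_iff compact_imp_bounded)
  have int: "integrable M (\<lambda>x. x)"
    using AE B by (intro integrable_const_bound[where B = B]) (auto elim!: eventually_mono)
  define b where "b = (\<integral>x. x \<partial>M)"
  have inner_b: "(\<integral>x. \<zeta> \<bullet> x \<partial>M) = \<zeta> \<bullet> b" for \<zeta>
    unfolding b_def using int by (intro integral_inner_right) auto
  have int': "integrable M (\<lambda>x. \<zeta> \<bullet> x)" for \<zeta>
    using int by (intro integrable_inner_right) auto
  have "b \<in> K"
  proof (rule ccontr)
    assume "b \<notin> K"
    then obtain a \<beta> where a: "a \<bullet> b < \<beta>" "\<And>x. x \<in> K \<Longrightarrow> \<beta> < a \<bullet> x"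
      using separating_hyperplane_closed_point[of K b] K compact_imp_closed by blast
    have "(\<integral>x. \<beta> \<partial>M) \<le> (\<integral>x. a \<bullet> x \<partial>M)"
      using AE a by (intro integral_mono_AE int') (auto elim!: eventually_mono intro: less_imp_le)
    then show False using a(1) by (simp add: inner_b prob_space)
  qed
  moreover have "ennreal (exp (\<zeta> \<bullet> b)) \<le> (\<integral>\<^sup>+w. ennreal (exp (\<zeta> \<bullet> w)) \<partial>M)" for \<zeta>
  proof -
    have bd: "exp (\<zeta> \<bullet> x) \<le> exp (norm \<zeta> * B)" if "x \<in> K" for x
      using norm_cauchy_schwarz[of \<zeta> x] mult_left_mono[OF B[OF that], of "norm \<zeta>"] by simp
    have inte: "integrable M (\<lambda>x. exp (\<zeta> \<bullet> x))"
      using AE bd by (intro integrable_const_bound[where B = "exp (norm \<zeta> * B)"])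
        (auto elim!: eventually_mono)
    \<comment> \<open>The integrand is the tangent line of \<open>exp\<close> at
      \<open>\<zeta> \<bullet> b\<close>, evaluated at \<open>\<zeta> \<bullet> x\<close>; it lies
      below \<open>exp\<close> and its linear part has mean zero.\<close>
    have "exp (\<zeta> \<bullet> b) = (\<integral>x. exp (\<zeta> \<bullet> b) * (1 - \<zeta> \<bullet> b) + exp (\<zeta> \<bullet> b) * (\<zeta> \<bullet> x) \<partial>M)"
      using int' by (simp add: inner_b prob_space algebra_simps)
    also have "\<dots> \<le> (\<integral>x. exp (\<zeta> \<bullet> x) \<partial>M)"
    proof (rule integral_mono)
      fix x
      have "exp (\<zeta> \<bullet> b) * (1 + (\<zeta> \<bullet> x - \<zeta> \<bullet> b)) \<le> exp (\<zeta> \<bullet> b) * exp (\<zeta> \<bullet> x - \<zeta> \<bullet> b)"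
        by (intro mult_left_mono exp_ge_add_one_self) auto
      then show "exp (\<zeta> \<bullet> b) * (1 - \<zeta> \<bullet> b) + exp (\<zeta> \<bullet> b) * (\<zeta> \<bullet> x) \<le> exp (\<zeta> \<bullet> x)"
        by (simp add: algebra_simps flip: exp_add)
    qed (use int' inte in auto)
    finally have "ennreal (exp (\<zeta> \<bullet> b)) \<le> ennreal (\<integral>x. exp (\<zeta> \<bullet> x) \<partial>M)"
      by (rule ennreal_leI)
    also have "\<dots> = (\<integral>\<^sup>+w. ennreal (exp (\<zeta> \<bullet> w)) \<partial>M)"
      using inte by (intro nn_integral_eq_integral[symmetric]) auto
    finally show ?thesis .
  qed
  ultimately show ?thesis using that by blast
qed

text \<open>Each low value \<open>f y\<close> is compared with the value at the midpoint of
  \<open>x0\<close> and \<open>y\<close>: replacing one of the two factors \<open>sqrt (f y)\<close>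
  by its upper bound gains \<open>exp (-u/2)\<close>, and integrating over midpoints costs
  \<open>2 ^ DIM('a)\<close>. In use, \<open>2 * f x0\<close> is an upper bound of
  \<open>f\<close>.\<close>

lemma nn_integral_low_values_le:
  fixes f :: "'a::euclidean_space \<Rightarrow> real"
  assumes f: "log_concave_fun f" and [measurable]: "f \<in> borel_measurable borel"
    and x0: "0 < f x0"
  shows "(\<integral>\<^sup>+x. ennreal (f x) * indicator {x. f x < 2 * f x0 * exp (-u)} x \<partial>lborel)
    \<le> ennreal (2 * 2 ^ DIM('a) * exp (-u/2)) * (\<integral>\<^sup>+x. ennreal (f x) \<partial>lborel)"
proof -
  let ?h = "\<lambda>y. f ((1/2) *\<^sub>R x0 + (1/2) *\<^sub>R y)"
  have pw: "f y \<le> 2 * exp (-u/2) * ?h y" if "f y < 2 * f x0 * exp (-u)" for y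
  proof -
    have f0: "0 \<le> f y" using f by (rule log_concave_fun_nonneg)
    have "f y = sqrt (f y) * sqrt (f y)" using f0 by simp
    also have "\<dots> \<le> sqrt (2 * f x0 * exp (-u)) * sqrt (f y)"
      using that f0 by (intro mult_right_mono real_sqrt_le_mono) auto
    also have "\<dots> = sqrt 2 * sqrt (exp (-u)) * (sqrt (f x0) * sqrt (f y))"
      by (simp add: real_sqrt_mult)
    also have "sqrt (exp (-u)) = exp (-u/2)"
      by (rule real_sqrt_unique) (simp_all add: power2_eq_square flip: exp_add)
    also have "sqrt (f x0) * sqrt (f y) \<le> ?h y"
      using log_concave_funD[OF f, of "1/2" x0 y] x0 f0 by (simp add: powr_half_sqrt)
    also have "sqrt 2 * exp (-u/2) * ?h y \<le> 2 * exp (-u/2) * ?h y"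
      using log_concave_fun_nonneg[OF f] sqrt2_less_2 by (intro mult_right_mono) auto
    finally show ?thesis by simp
  qed
  have "(\<integral>\<^sup>+x. ennreal (f x) * indicator {x. f x < 2 * f x0 * exp (-u)} x \<partial>lborel)
      \<le> (\<integral>\<^sup>+x. ennreal (2 * exp (-u/2)) * ennreal (?h x) \<partial>lborel)"
  proof (rule nn_integral_mono)
    fix x
    have "ennreal (f x) \<le> ennreal (2 * exp (-u/2)) * ennreal (?h x)" if "f x < 2 * f x0 * exp (-u)"
      unfolding ennreal_mult'[OF log_concave_fun_nonneg[OF f], symmetric]
      using pw[OF that] by (simp add: ennreal_leI flip: ennreal_mult')
    then show "ennreal (f x) * indicator {x. f x < 2 * f x0 * exp (-u)} x
        \<le> ennreal (2 * exp (-u/2)) * ennreal (?h x)"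
      by (auto simp: indicator_def)
  qed
  also have "\<dots> = ennreal (2 * exp (-u/2)) * (\<integral>\<^sup>+x. ennreal (?h x) \<partial>lborel)"
    by (intro nn_integral_cmult) auto
  also have "(\<integral>\<^sup>+x. ennreal (?h x) \<partial>lborel) = ennreal (2 ^ DIM('a)) * (\<integral>\<^sup>+x. ennreal (f x) \<partial>lborel)"
  proof -
    have "(\<integral>\<^sup>+x. ennreal (f x) \<partial>lborel) = ennreal ((1/2) ^ DIM('a)) * (\<integral>\<^sup>+x. ennreal (?h x) \<partial>lborel)"
      by (rule nn_integral_lborel_affine) auto
    then show ?thesis
      by (simp add: mult.assoc[symmetric] power_one_over flip: ennreal_mult'')
  qed
  finally show ?thesis
    by (simp add: ennreal_mult mult_ac)
qed

text \<open>The argument on the right inverts the contraction with centre \<open>b\<close> and ratio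
  \<open>1 - e\<close>, so the right side is the mass of the contracted \<open>L\<close>. The
  Jacobian costs \<open>(1 - e) ^ DIM('a)\<close>, and moving a point towards \<open>b\<close>
  lowers \<open>f\<close> at most by the factor \<open>exp (-v * e)\<close>.\<close>

lemma nn_integral_contracted_superlevel_ge:
  fixes f :: "'a::euclidean_space \<Rightarrow> real"
  assumes f: "log_concave_fun f" and [measurable]: "f \<in> borel_measurable borel"
    and e: "0 < e" "e < 1" and le: "\<And>x. f x \<le> m" and b: "m * exp (-v) \<le> f b"
    and [measurable]: "L \<in> sets borel"
  shows "ennreal ((1 - e) ^ DIM('a) * exp (-v * e)) * (\<integral>\<^sup>+x. ennreal (f x) * indicator L x \<partial>lborel)
    \<le> (\<integral>\<^sup>+x. ennreal (f x) * indicator L ((1 / (1 - e)) *\<^sub>R (x - e *\<^sub>R b)) \<partial>lborel)"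
proof -
  have pw: "exp (-v * e) * f y \<le> f (e *\<^sub>R b + (1 - e) *\<^sub>R y)" for y
  proof (cases "f y = 0")
    case True
    then show ?thesis using log_concave_fun_nonneg[OF f] by simp
  next
    case False
    then have fy: "0 < f y" using log_concave_fun_nonneg[OF f, of y] by simp
    \<comment> \<open>Splitting \<open>f y\<close> into the powers \<open>e\<close> and
      \<open>1 - e\<close> lets the first one absorb \<open>exp (-v * e)\<close>; its base
      \<open>f y * exp (-v)\<close> is at most \<open>m * exp (-v)\<close>, hence at most
      \<open>f b\<close>.\<close>
    have "exp (-v * e) * f y = (f y * exp (-v)) powr e * f y powr (1 - e)"
      using fy by (simp add: powr_mult exp_powr_real mult.assoc flip: powr_add)
    also have "\<dots> \<le> f b powr e * f y powr (1 - e)"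
      using fy e by (intro mult_right_mono powr_mono2 order_trans[OF _ b])
        (auto intro!: mult_right_mono le)
    also have "\<dots> \<le> f (e *\<^sub>R b + (1 - e) *\<^sub>R y)"
      using e by (intro log_concave_funD[OF f])
    finally show ?thesis .
  qed
  have "(\<integral>\<^sup>+x. ennreal (f x) * indicator L ((1 / (1 - e)) *\<^sub>R (x - e *\<^sub>R b)) \<partial>lborel)
    = ennreal ((1 - e) ^ DIM('a)) *
        (\<integral>\<^sup>+y. ennreal (f (e *\<^sub>R b + (1 - e) *\<^sub>R y)) * indicator L y \<partial>lborel)"
    using e by (subst nn_integral_lborel_affine[where t = "e *\<^sub>R b" and c = "1 - e"]) auto
  also have "\<dots> \<ge> ennreal ((1 - e) ^ DIM('a)) *
        (\<integral>\<^sup>+y. ennreal (exp (-v * e)) * (ennreal (f y) * indicator L y) \<partial>lborel)"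
    using pw by (intro mult_left_mono nn_integral_mono)
      (auto simp: indicator_def simp flip: ennreal_mult' intro!: ennreal_leI)
  finally show ?thesis
    using e by (simp add: nn_integral_cmult mult.assoc ennreal_mult)
qed

text \<open>Substitute \<open>(1 - e) *\<^sub>R y + e *\<^sub>R w\<close> with \<open>w\<close> in
  \<open>K\<close>: the Jacobian is \<open>e ^ DIM('a)\<close>, log-concavity costs
  \<open>exp (-u)\<close>, and the hypothesis on \<open>b\<close>, which is Jensen's inequality with
  total mass \<open>I\<close>, replaces \<open>w\<close> by \<open>b\<close> in the
  exponential.\<close>

lemma nn_integral_exp_log_concave_ge:
  fixes f :: "'a::euclidean_space \<Rightarrow> real"
  assumes f: "log_concave_fun f" and [measurable]: "f \<in> borel_measurable borel"
    and e: "0 < e" "e < 1" and m: "0 < m" and le: "\<And>x. f x \<le> m"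
    and y: "m * exp (-u) \<le> f y" and u: "0 \<le> u"
    and [measurable]: "K \<in> sets borel"
    and b: "\<And>\<zeta>. ennreal (exp (\<zeta> \<bullet> b)) * I
      \<le> (\<integral>\<^sup>+w. ennreal (exp (\<zeta> \<bullet> w)) * (ennreal (f w) * indicator K w) \<partial>lborel)"
  shows "ennreal (e ^ DIM('a) * exp (-u) * exp (\<xi> \<bullet> ((1 - e) *\<^sub>R y + e *\<^sub>R b))) * I
    \<le> (\<integral>\<^sup>+x. ennreal (exp (\<xi> \<bullet> x)) * ennreal (f x) \<partial>lborel)"
proof -
  have pw: "exp (-u) * f w \<le> f ((1 - e) *\<^sub>R y + e *\<^sub>R w)" for w
  proof -
    have f0: "0 \<le> f w" using f by (rule log_concave_fun_nonneg)
    have "exp (-u) * f w \<le> exp (-u * (1 - e)) * (m powr (1 - e) * f w powr e)"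
    proof (rule mult_mono)
      show "exp (-u) \<le> exp (-u * (1 - e))" using u e by (simp add: algebra_simps)
      have "f w = f w powr (1 - e) * f w powr e"
        using f0 by (cases "f w = 0") (auto simp flip: powr_add)
      also have "\<dots> \<le> m powr (1 - e) * f w powr e"
        using f0 e le by (intro mult_right_mono powr_mono2) auto
      finally show "f w \<le> m powr (1 - e) * f w powr e" .
    qed (use f0 in auto)
    also have "\<dots> = (m * exp (-u)) powr (1 - e) * f w powr (1 - (1 - e))"
      using m by (simp add: powr_mult exp_powr_real mult_ac)
    also have "\<dots> \<le> f y powr (1 - e) * f w powr (1 - (1 - e))"
      using m e by (intro mult_right_mono powr_mono2 y) auto
    also have "\<dots> \<le> f ((1 - e) *\<^sub>R y + (1 - (1 - e)) *\<^sub>R w)"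
      using e by (intro log_concave_funD[OF f]) auto
    finally show ?thesis by simp
  qed
  let ?A = "exp (-u) * exp (\<xi> \<bullet> ((1 - e) *\<^sub>R y))"
  \<comment> \<open>The hypothesis on \<open>b\<close> is taken at \<open>e *\<^sub>R \<xi>\<close>,
    the vector paired with \<open>w\<close> after the substitution.\<close>
  have "ennreal ?A * (ennreal (exp ((e *\<^sub>R \<xi>) \<bullet> b)) * I)
    \<le> ennreal ?A * (\<integral>\<^sup>+w. ennreal (exp ((e *\<^sub>R \<xi>) \<bullet> w)) * (ennreal (f w) * indicator K w) \<partial>lborel)"
    by (intro mult_left_mono b) auto
  also have "\<dots> = (\<integral>\<^sup>+w. ennreal ?A * (ennreal (exp ((e *\<^sub>R \<xi>) \<bullet> w)) * (ennreal (f w) * indicator K w)) \<partial>lborel)"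
    by (intro nn_integral_cmult[symmetric]) auto
  also have "\<dots> \<le> (\<integral>\<^sup>+w. ennreal (exp (\<xi> \<bullet> ((1 - e) *\<^sub>R y + e *\<^sub>R w))) * ennreal (f ((1 - e) *\<^sub>R y + e *\<^sub>R w)) \<partial>lborel)"
  proof (rule nn_integral_mono)
    fix w
    have "?A * (exp ((e *\<^sub>R \<xi>) \<bullet> w) * f w) = exp (\<xi> \<bullet> ((1 - e) *\<^sub>R y + e *\<^sub>R w)) * (exp (-u) * f w)"
      by (simp add: inner_add_right exp_add)
    also have "\<dots> \<le> exp (\<xi> \<bullet> ((1 - e) *\<^sub>R y + e *\<^sub>R w)) * f ((1 - e) *\<^sub>R y + e *\<^sub>R w)"
      by (intro mult_left_mono pw) auto
    finally show "ennreal ?A * (ennreal (exp ((e *\<^sub>R \<xi>) \<bullet> w)) * (ennreal (f w) * indicator K w))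
      \<le> ennreal (exp (\<xi> \<bullet> ((1 - e) *\<^sub>R y + e *\<^sub>R w))) * ennreal (f ((1 - e) *\<^sub>R y + e *\<^sub>R w))"
      using log_concave_fun_nonneg[OF f]
      by (auto simp: indicator_def simp flip: ennreal_mult' ennreal_mult'' intro!: ennreal_leI)
  qed
  finally have *: "ennreal ?A * (ennreal (exp ((e *\<^sub>R \<xi>) \<bullet> b)) * I) \<le> \<dots>" .
  have "ennreal (e ^ DIM('a) * exp (-u) * exp (\<xi> \<bullet> ((1 - e) *\<^sub>R y + e *\<^sub>R b))) * I
    = ennreal (e ^ DIM('a)) * (ennreal ?A * (ennreal (exp ((e *\<^sub>R \<xi>) \<bullet> b)) * I))"
    using e by (simp add: inner_add_right exp_add ennreal_mult mult_ac)
  also have "\<dots> \<le> ennreal (e ^ DIM('a)) * (\<integral>\<^sup>+w. ennreal (exp (\<xi> \<bullet> ((1 - e) *\<^sub>R y + e *\<^sub>R w))) * ennreal (f ((1 - e) *\<^sub>R y + e *\<^sub>R w)) \<partial>lborel)"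
    by (intro mult_left_mono *) auto
  also have "\<dots> = (\<integral>\<^sup>+x. ennreal (exp (\<xi> \<bullet> x)) * ennreal (f x) \<partial>lborel)"
    using e by (subst nn_integral_lborel_affine[where t = "(1 - e) *\<^sub>R y" and c = e]) auto
  finally show ?thesis .
qed

text \<open>Complement of the estimate for low values, with the threshold tuned so that the
  discarded fraction is at most \<open>exp (-s)\<close>.\<close>

lemma nn_integral_superlevel_ge:
  fixes f :: "'a::euclidean_space \<Rightarrow> real"
  assumes f: "log_concave_fun f" and [measurable]: "f \<in> borel_measurable borel"
    and x0: "0 < f x0" and V: "(\<integral>\<^sup>+x. ennreal (f x) \<partial>lborel) = ennreal V" "0 \<le> V"
  shows "ennreal ((1 - exp (-s)) * V) \<le> (\<integral>\<^sup>+x. ennreal (f x) *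
    indicator {x. 2 * f x0 * exp (- (2 * s + 2 * DIM('a) + 2)) \<le> f x} x \<partial>lborel)"
    (is "_ \<le> ?A")
proof -
  let ?u = "2 * s + 2 * DIM('a) + 2"
  let ?B = "\<integral>\<^sup>+x. ennreal (f x) * indicator {x. f x < 2 * f x0 * exp (-?u)} x \<partial>lborel"
  \<comment> \<open>The summand \<open>2 * DIM('a) + 2\<close> of \<open>?u\<close> supplies one
    factor \<open>exp (-1)\<close> against each of the \<open>DIM('a) + 1\<close> factors 2.\<close>
  have "2 * 2 ^ DIM('a) * exp (-?u/2) = (2 / exp 1) * (2 / exp 1) ^ DIM('a) * exp (-s)"
  proof -
    have "exp (-?u/2) = exp (-s) * exp (-1) * exp (-1) ^ DIM('a)"
      by (simp add: field_simps flip: exp_of_nat_mult exp_add)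
    then show ?thesis by (simp add: power_divide exp_minus field_simps)
  qed
  also have "\<dots> \<le> 1 * 1 * exp (-s)"
  proof -
    have "2 \<le> exp (1::real)" using exp_ge_add_one_self[of 1] by simp
    then show ?thesis by (intro mult_mono power_le_one) (auto simp: field_simps)
  qed
  finally have q: "2 * 2 ^ DIM('a) * exp (-?u/2) \<le> exp (-s)" by simp
  have "?B \<le> ennreal (2 * 2 ^ DIM('a) * exp (-?u/2)) * ennreal V"
    using nn_integral_low_values_le[OF f assms(2) x0, of ?u] by (simp only: V)
  also have "\<dots> \<le> ennreal (exp (-s)) * ennreal V"
    using q by (intro mult_right_mono ennreal_leI) auto
  finally have B: "?B \<le> ennreal (exp (-s) * V)"
    using V by (simp add: ennreal_mult)
  have "ennreal V = (\<integral>\<^sup>+x. ennreal (f x) * indicator {x. 2 * f x0 * exp (-?u) \<le> f x} x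
      + ennreal (f x) * indicator {x. f x < 2 * f x0 * exp (-?u)} x \<partial>lborel)"
    unfolding V(1)[symmetric] by (intro nn_integral_cong) (auto simp: indicator_def)
  also have "\<dots> = ?A + ?B"
    by (intro nn_integral_add) auto
  finally have AB: "ennreal V = ?A + ?B" .
  \<comment> \<open>Finiteness allows the subtraction to be carried out in the reals, where it is
    not truncated.\<close>
  then have "?A \<noteq> \<infinity>" by auto
  then obtain a where a: "?A = ennreal a" "0 \<le> a"
    by (cases ?A) auto
  have "ennreal V \<le> ennreal (a + exp (-s) * V)"
    unfolding AB using B a V by (simp add: add_left_mono)
  then have "V \<le> a + exp (-s) * V"
    using a V by (subst (asm) ennreal_le_iff) auto
  then show ?thesis
    unfolding a(1) by (intro ennreal_leI) (simp add: algebra_simps)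
qed

text \<open>Normalise \<open>f\<close> restricted to \<open>K\<close> to a probability density,
  apply Jensen's inequality at its barycentre and multiply back by the mass
  \<open>i\<close>.\<close>

lemma weighted_exp_barycentre_le:
  fixes f :: "'a::euclidean_space \<Rightarrow> real"
  assumes nonneg: "\<And>x. 0 \<le> f x" and [measurable]: "f \<in> borel_measurable borel"
    and K: "compact K" "convex K"
    and I: "(\<integral>\<^sup>+x. ennreal (f x) * indicator K x \<partial>lborel) = ennreal i" "0 < i"
  obtains b where "b \<in> K"
    and "\<And>\<zeta>. ennreal (exp (\<zeta> \<bullet> b)) * ennreal i
      \<le> (\<integral>\<^sup>+w. ennreal (exp (\<zeta> \<bullet> w)) * (ennreal (f w) * indicator K w) \<partial>lborel)"
proof -
  have [measurable]: "K \<in> sets borel" using K(1) by (simp add: compact_imp_closed)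
  define N where "N = density lborel (\<lambda>x. ennreal (1 / i) * (ennreal (f x) * indicator K x))"
  have sets_N: "sets N = sets borel" by (simp add: N_def)
  have "emeasure N (space N) = ennreal (1 / i) * (\<integral>\<^sup>+x. ennreal (f x) * indicator K x \<partial>lborel)"
    by (simp add: N_def emeasure_density nn_integral_cmult)
  also have "\<dots> = 1"
    using I(2) by (simp add: I(1) flip: ennreal_mult')
  finally have "prob_space N" by (rule prob_spaceI)
  moreover have "AE x in N. x \<in> K"
    unfolding N_def by (subst AE_density) (auto simp: indicator_def)
  ultimately obtain b where b: "b \<in> K"
    "\<And>\<zeta>. ennreal (exp (\<zeta> \<bullet> b)) \<le> (\<integral>\<^sup>+w. ennreal (exp (\<zeta> \<bullet> w)) \<partial>N)"
    using exp_barycentre_le[OF _ sets_N K] by metis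
  have "ennreal (exp (\<zeta> \<bullet> b)) * ennreal i
      \<le> (\<integral>\<^sup>+w. ennreal (exp (\<zeta> \<bullet> w)) * (ennreal (f w) * indicator K w) \<partial>lborel)" (is "_ \<le> ?J") for \<zeta>
  proof -
    have "ennreal (exp (\<zeta> \<bullet> b)) * ennreal i \<le> (\<integral>\<^sup>+w. ennreal (exp (\<zeta> \<bullet> w)) \<partial>N) * ennreal i"
      by (intro mult_right_mono b) auto
    also have "(\<integral>\<^sup>+w. ennreal (exp (\<zeta> \<bullet> w)) \<partial>N) = ennreal (1 / i) * ?J"
      by (simp add: N_def nn_integral_density mult_ac flip: nn_integral_cmult)
    also have "\<dots> * ennreal i = ennreal (1 / i * i) * ?J"
      using I(2) by (subst ennreal_mult) (auto simp: mult_ac)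
    finally show ?thesis using I(2) by simp
  qed
  then show ?thesis using b(1) that by blast
qed

subsection \<open>The mass of balls\<close>

text \<open>A convex combination of two balls of radius \<open>\<rho>\<close> lies in the ball of
  radius \<open>\<rho>\<close> about the combined centre, so the inequality for compact sets passes
  to the centres.\<close>

lemma log_concave_fun_ball_mass:
  fixes M :: "'a::euclidean_space measure"
  assumes M: "log_concave_measure M"
  shows "log_concave_fun (\<lambda>x. measure M (cball x \<rho>))"
  unfolding log_concave_fun_def
proof (intro conjI allI impI)
  interpret prob_space M using M by (simp add: log_concave_measure_def)
  have sM: "sets M = sets borel" using M by (simp add: log_concave_measure_def)
  fix x y :: 'a and t :: real assume t: "0 < t" "t < 1"
  let ?S = "{t *\<^sub>R a + (1 - t) *\<^sub>R b | a b. a \<in> cball x \<rho> \<and> b \<in> cball y \<rho>}"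
  have "measure M (cball x \<rho>) powr t * measure M (cball y \<rho>) powr (1 - t) \<le> measure M ?S"
  proof -
    have "\<forall>A B t. compact A \<longrightarrow> compact B \<longrightarrow> 0 < t \<longrightarrow> t < 1 \<longrightarrow>
        measure M A powr t * measure M B powr (1 - t)
          \<le> measure M {t *\<^sub>R a + (1 - t) *\<^sub>R b | a b. a \<in> A \<and> b \<in> B}"
      using M unfolding log_concave_measure_def by blast
    from this[rule_format, of "cball x \<rho>" "cball y \<rho>" t] t show ?thesis by simp
  qed
  also have "?S \<subseteq> cball (t *\<^sub>R x + (1 - t) *\<^sub>R y) \<rho>"
  proof clarify
    fix a b assume ab: "a \<in> cball x \<rho>" "b \<in> cball y \<rho>"
    have "norm ((t *\<^sub>R x + (1 - t) *\<^sub>R y) - (t *\<^sub>R a + (1 - t) *\<^sub>R b))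
        = norm (t *\<^sub>R (x - a) + (1 - t) *\<^sub>R (y - b))"
      by (simp add: algebra_simps)
    also have "\<dots> \<le> t * norm (x - a) + (1 - t) * norm (y - b)"
      using t by (intro norm_triangle_le) simp
    also have "\<dots> \<le> t * \<rho> + (1 - t) * \<rho>"
      using ab t by (intro add_mono mult_left_mono) (auto simp: dist_norm)
    finally show "t *\<^sub>R a + (1 - t) *\<^sub>R b \<in> cball (t *\<^sub>R x + (1 - t) *\<^sub>R y) \<rho>"
      by (simp add: dist_norm algebra_simps)
  qed
  then have "measure M ?S \<le> measure M (cball (t *\<^sub>R x + (1 - t) *\<^sub>R y) \<rho>)"
    by (intro finite_measure_mono) (auto simp: sM)
  finally show "measure M (cball x \<rho>) powr t * measure M (cball y \<rho>) powr (1 - t)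
    \<le> measure M (cball (t *\<^sub>R x + (1 - t) *\<^sub>R y) \<rho>)" .
qed simp

text \<open>Upper semicontinuity: slightly enlarged balls about the limit contain the balls about
  late terms of the sequence, and they decrease to the closed ball, so continuity from above
  applies.\<close>

lemma closed_superlevel_ball_mass:
  fixes M :: "'a::euclidean_space measure"
  assumes "prob_space M" and sM: "sets M = sets borel"
  shows "closed {x. c \<le> measure M (cball x \<rho>)}"
  unfolding closed_sequential_limits
proof (intro allI impI, elim conjE)
  interpret prob_space M by fact
  fix X and x assume X: "\<forall>n. X n \<in> {x. c \<le> measure M (cball x \<rho>)}" and lim: "X \<longlonglongrightarrow> x"
  have ge: "c \<le> measure M (cball x (\<rho> + 1 / Suc n))" for n
  proof -
    have "eventually (\<lambda>k. dist (X k) x < 1 / Suc n) sequentially"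
      using lim by (rule tendstoD) simp
    then obtain k where k: "dist (X k) x < 1 / Suc n"
      by (auto simp: eventually_sequentially)
    have "cball (X k) \<rho> \<subseteq> cball x (\<rho> + 1 / Suc n)"
    proof
      fix y assume "y \<in> cball (X k) \<rho>"
      then show "y \<in> cball x (\<rho> + 1 / Suc n)"
        using k dist_triangle[of x y "X k"] by (simp add: dist_commute)
    qed
    then have "measure M (cball (X k) \<rho>) \<le> measure M (cball x (\<rho> + 1 / Suc n))"
      by (intro finite_measure_mono) (auto simp: sM)
    then show ?thesis using X by (auto intro: order_trans)
  qed
  have "(\<lambda>n. measure M (cball x (\<rho> + 1 / Suc n))) \<longlonglongrightarrow> measure M (\<Inter>n. cball x (\<rho> + 1 / Suc n))"
  proof (rule finite_Lim_measure_decseq)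
    show "decseq (\<lambda>n. cball x (\<rho> + 1 / Suc n))"
      unfolding decseq_def by (intro allI impI subset_cball) (simp add: frac_le)
  qed (auto simp: sM)
  also have "(\<Inter>n. cball x (\<rho> + 1 / Suc n)) = cball x \<rho>"
  proof (intro equalityI subsetI)
    fix y assume y: "y \<in> (\<Inter>n. cball x (\<rho> + 1 / Suc n))"
    have "(\<lambda>n. \<rho> + 1 / Suc n) \<longlonglongrightarrow> \<rho> + 0"
      by (intro tendsto_add tendsto_const LIMSEQ_Suc[OF lim_1_over_n])
    then have "dist x y \<le> \<rho> + 0"
      using y by (intro LIMSEQ_le_const) auto
    then show "y \<in> cball x \<rho>" by simp
  next
    fix y assume y: "y \<in> cball x \<rho>"
    show "y \<in> (\<Inter>n. cball x (\<rho> + 1 / Suc n))"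
    proof
      fix n
      have "0 < 1 / real (Suc n)" by simp
      then show "y \<in> cball x (\<rho> + 1 / Suc n)" using y unfolding mem_cball by linarith
    qed
  qed
  finally show "x \<in> {x. c \<le> measure M (cball x \<rho>)}"
    using ge by (auto intro: LIMSEQ_le_const)
qed

lemma borel_measurable_ball_mass:
  fixes M :: "'a::euclidean_space measure"
  assumes "prob_space M" "sets M = sets borel"
  shows "(\<lambda>x. measure M (cball x \<rho>)) \<in> borel_measurable borel"
  unfolding borel_measurable_iff_ge
  using closed_superlevel_ball_mass[OF assms] by auto

text \<open>Some ball about the origin has mass above \<open>1 - c\<close>, so a ball of mass at
  least \<open>c\<close> must meet it; this bounds the centres.\<close>

lemma compact_superlevel_ball_mass:
  fixes M :: "'a::euclidean_space measure"
  assumes "prob_space M" and sM: "sets M = sets borel" and c: "0 < c"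
  shows "compact {x. c \<le> measure M (cball x \<rho>)}"
proof -
  interpret prob_space M by fact
  have "(\<lambda>n. measure M (cball 0 (real n))) \<longlonglongrightarrow> measure M (\<Union>n. cball (0::'a) (real n))"
    by (intro finite_Lim_measure_incseq) (auto simp: sM incseq_def)
  also have "(\<Union>n. cball (0::'a) (real n)) = space M"
    using real_arch_simple sets_eq_imp_space_eq[OF sM] by auto
  finally have "eventually (\<lambda>n. 1 - c < measure M (cball 0 (real n))) sequentially"
    using c by (intro order_tendstoD(1)[where y = 1]) (auto simp: prob_space)
  then obtain R where R: "1 - c < measure M (cball 0 (real R))"
    by (auto simp: eventually_sequentially)
  have "norm x \<le> R + \<rho>" if x: "c \<le> measure M (cball x \<rho>)" for x
  proof (rule ccontr)
    assume "\<not> norm x \<le> R + \<rho>"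
    then have far: "real R + \<rho> < norm x" by simp
    have "y \<notin> cball 0 (real R) \<inter> cball x \<rho>" for y
      using norm_triangle_sub[of x y] far by (auto simp: dist_norm)
    then have "cball 0 (real R) \<inter> cball x \<rho> = {}" by blast
    then have "measure M (cball 0 (real R)) + measure M (cball x \<rho>)
        = measure M (cball 0 (real R) \<union> cball x \<rho>)"
      by (intro finite_measure_Union[symmetric]) (auto simp: sM)
    also have "\<dots> \<le> 1" by (rule prob_le_1)
    finally show False using R x by simp
  qed
  then have "bounded {x. c \<le> measure M (cball x \<rho>)}"
    unfolding bounded_iff by blast
  then show ?thesis
    using closed_superlevel_ball_mass[OF assms(1,2)] by (simp add: compact_eq_bounded_closed)
qed

text \<open>Tonelli's theorem for the symmetric relation \<open>dist w x \<le> \<rho>\<close>. Up to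
  normalisation, the ball mass is the density of \<open>M\<close> convolved with the uniform
  distribution on a ball.\<close>

lemma nn_integral_ball_mass:
  fixes M :: "'a::euclidean_space measure" and g :: "'a \<Rightarrow> ennreal"
  assumes "prob_space M" and sM: "sets M = sets borel" and [measurable]: "g \<in> borel_measurable borel"
  shows "(\<integral>\<^sup>+x. g x * ennreal (measure M (cball x \<rho>)) \<partial>lborel)
    = (\<integral>\<^sup>+w. (\<integral>\<^sup>+x. g x * indicator (cball w \<rho>) x \<partial>lborel) \<partial>M)"
proof -
  interpret prob_space M by fact
  interpret pair_sigma_finite lborel M by unfold_locales
  have [measurable_cong]: "sets M = sets borel" by (fact sM)
  have "(\<integral>\<^sup>+x. g x * ennreal (measure M (cball x \<rho>)) \<partial>lborel)
      = (\<integral>\<^sup>+x. (\<integral>\<^sup>+w. g x * indicator {w. dist w x \<le> \<rho>} w \<partial>M) \<partial>lborel)"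
  proof (rule nn_integral_cong)
    fix x :: 'a
    have eq: "{w. dist w x \<le> \<rho>} = cball x \<rho>" by (auto simp: dist_commute)
    show "g x * ennreal (measure M (cball x \<rho>))
        = (\<integral>\<^sup>+w. g x * indicator {w. dist w x \<le> \<rho>} w \<partial>M)"
      unfolding eq by (simp add: nn_integral_cmult_indicator emeasure_eq_measure sM)
  qed
  also have "\<dots> = (\<integral>\<^sup>+w. (\<integral>\<^sup>+x. g x * indicator {w. dist w x \<le> \<rho>} w \<partial>lborel) \<partial>M)"
  proof (rule Fubini'[symmetric])
    show "(\<lambda>(x, w). g x * indicator {w. dist w x \<le> \<rho>} w) \<in> borel_measurable (lborel \<Otimes>\<^sub>M M)"
      by (simp add: split_beta indicator_def) measurable
  qed
  finally show ?thesis by (simp add: indicator_def)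
qed

subsection \<open>Tails of the Cramer transform\<close>

text \<open>For \<open>\<delta> = 0\<close> this is the sublevel set of the Cramer transform,
  exponentiated to avoid extended-real subtraction. The slack \<open>\<delta> * norm \<xi>\<close>
  is the most that \<open>x \<bullet> \<xi>\<close> changes when \<open>x\<close> moves by
  \<open>\<delta>\<close>, which accommodates the smoothing by balls.\<close>

definition relaxed_cramer_sublevel :: "'a::euclidean_space measure \<Rightarrow> real \<Rightarrow> real \<Rightarrow> 'a set" where
  "relaxed_cramer_sublevel M c \<delta> =
     {x. \<forall>\<xi>. ennreal (exp (x \<bullet> \<xi> - c - \<delta> * norm \<xi>)) \<le> (\<integral>\<^sup>+z. ennreal (exp (\<xi> \<bullet> z)) \<partial>M)}"

lemma closed_relaxed_cramer_sublevel: "closed (relaxed_cramer_sublevel M c \<delta>)"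
  unfolding relaxed_cramer_sublevel_def
  by (intro closed_Collect_all closed_Collect_le continuous_on_ennreal continuous_intros)

text \<open>Monotonicity of \<open>exp\<close> for finite positive \<open>y\<close>; at
  \<open>y = 0\<close> both sides are false, and at \<open>y = \<infinity>\<close> both are
  true.\<close>

lemma ereal_diff_ln_ennreal_le_iff:
  "ereal a - ln_ennreal y \<le> ereal c \<longleftrightarrow> ennreal (exp (a - c)) \<le> y"
proof (cases y rule: ennreal_cases)
  case (real r)
  show ?thesis
  proof (cases "r = 0")
    case False
    then have "a - ln r \<le> c \<longleftrightarrow> exp (a - c) \<le> r"
      using real by (subst ln_ge_iff[symmetric]) auto
    then show ?thesis using real False by (simp add: ln_ennreal_def)
  qed (use real in \<open>simp add: ln_ennreal_def\<close>)
qed (simp add: ln_ennreal_def)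

text \<open>As the right-hand set is closed, this also supplies measurability of the tail events of
  \<open>cramer M\<close>.\<close>

lemma cramer_le_iff: "cramer M x \<le> ereal c \<longleftrightarrow> x \<in> relaxed_cramer_sublevel M c 0"
  by (simp add: cramer_def SUP_le_iff log_laplace_def ereal_diff_ln_ennreal_le_iff
      relaxed_cramer_sublevel_def)

lemma relaxed_cramer_sublevel_mono:
  "\<delta> \<le> \<delta>' \<Longrightarrow> relaxed_cramer_sublevel M c \<delta> \<subseteq> relaxed_cramer_sublevel M c \<delta>'"
  unfolding relaxed_cramer_sublevel_def
proof (intro Collect_mono impI allI)
  fix x \<xi> assume "\<delta> \<le> \<delta>'"
    and x: "\<forall>\<xi>. ennreal (exp (x \<bullet> \<xi> - c - \<delta> * norm \<xi>)) \<le> (\<integral>\<^sup>+z. ennreal (exp (\<xi> \<bullet> z)) \<partial>M)"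
  then have "ennreal (exp (x \<bullet> \<xi> - c - \<delta>' * norm \<xi>)) \<le> ennreal (exp (x \<bullet> \<xi> - c - \<delta> * norm \<xi>))"
    by (auto intro!: ennreal_leI mult_right_mono)
  also note x[rule_format, of \<xi>]
  finally show "ennreal (exp (x \<bullet> \<xi> - c - \<delta>' * norm \<xi>)) \<le> (\<integral>\<^sup>+z. ennreal (exp (\<xi> \<bullet> z)) \<partial>M)" .
qed

text \<open>For each fixed \<open>\<xi>\<close> the slack tends to 0 and the inequality survives the
  limit. This is how the smoothing scale is removed.\<close>

lemma INT_relaxed_cramer_sublevel:
  "(\<Inter>k. relaxed_cramer_sublevel M c (1 / Suc k)) = relaxed_cramer_sublevel M c 0"
proof (intro equalityI subsetI)
  fix x assume x: "x \<in> (\<Inter>k. relaxed_cramer_sublevel M c (1 / Suc k))"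
  have "ennreal (exp (x \<bullet> \<xi> - c - 0 * norm \<xi>)) \<le> (\<integral>\<^sup>+z. ennreal (exp (\<xi> \<bullet> z)) \<partial>M)" for \<xi>
  proof (rule LIMSEQ_le_const2)
    show "(\<lambda>k. ennreal (exp (x \<bullet> \<xi> - c - 1 / Suc k * norm \<xi>))) \<longlonglongrightarrow> ennreal (exp (x \<bullet> \<xi> - c - 0 * norm \<xi>))"
      by (intro tendsto_ennrealI tendsto_intros LIMSEQ_Suc[OF lim_1_over_n])
  qed (use x in \<open>auto simp: relaxed_cramer_sublevel_def\<close>)
  then show "x \<in> relaxed_cramer_sublevel M c 0" by (auto simp: relaxed_cramer_sublevel_def)
next
  fix x assume "x \<in> relaxed_cramer_sublevel M c 0"
  then show "x \<in> (\<Inter>k. relaxed_cramer_sublevel M c (1 / Suc k))"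
    using relaxed_cramer_sublevel_mono[of 0 "1 / Suc k" M c for k] by fastforce
qed

text \<open>The mass of \<open>f\<close> on the contracted set counts pairs \<open>(w, x)\<close> at
  distance at most \<open>\<rho>\<close>, and every such \<open>w\<close> lies in \<open>?T\<close>;
  dividing by the ball volume \<open>V\<close> bounds the measure of \<open>?T\<close>. One
  \<open>\<rho>\<close> of the slack pays for passing from \<open>f\<close> to \<open>M\<close>, the
  other for passing from \<open>x\<close> to \<open>w\<close>.\<close>

lemma measure_relaxed_cramer_sublevel_ge:
  fixes M :: "'a::euclidean_space measure"
  assumes M: "log_concave_measure M" and \<rho>: "0 < \<rho>" and s: "0 < s"
  defines "n \<equiv> real DIM('a)"
  shows "1 - (3 * n + 5) * exp (-s)
    \<le> measure M (relaxed_cramer_sublevel M (n * s + 2 * s + 2 * n + 3) (2 * \<rho>))"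
    (is "_ \<le> measure M ?T")
proof -
  have pM: "prob_space M" and sM: "sets M = sets borel"
    using M by (auto simp: log_concave_measure_def)
  interpret prob_space M by (fact pM)
  have [measurable_cong]: "sets M = sets borel" by (fact sM)
  define c where "c = n * s + 2 * s + 2 * n + 3"
  define f where "f = (\<lambda>x. measure M (cball x \<rho>))"
  define V where "V = unit_ball_vol (real DIM('a)) * \<rho> ^ DIM('a)"
  have V: "0 < V" using \<rho> by (simp add: V_def)
  have vol: "emeasure lborel (cball (w::'a) \<rho>) = ennreal V" for w
    using \<rho> by (simp add: V_def emeasure_cball)
  have f: "log_concave_fun f" unfolding f_def by (rule log_concave_fun_ball_mass[OF M])
  have f_meas [measurable]: "f \<in> borel_measurable borel"
    unfolding f_def by (rule borel_measurable_ball_mass[OF pM sM])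
  have fint: "(\<integral>\<^sup>+x. g x * ennreal (f x) \<partial>lborel)
      = (\<integral>\<^sup>+w. (\<integral>\<^sup>+x. g x * indicator (cball w \<rho>) x \<partial>lborel) \<partial>M)"
    if "g \<in> borel_measurable borel" for g
    unfolding f_def by (rule nn_integral_ball_mass[OF pM sM that])
  have Vf: "(\<integral>\<^sup>+x. ennreal (f x) \<partial>lborel) = ennreal V"
    using fint[of "\<lambda>_. 1"] by (simp add: vol emeasure_space_1)
  \<comment> \<open>A point where \<open>f\<close> exceeds half of its supremum; hence the factor 2
    in all thresholds.\<close>
  obtain x0 where x0: "0 < f x0" "\<And>x. f x \<le> 2 * f x0"
  proof -
    have bdd: "bdd_above (range f)" unfolding f_def by (rule bdd_aboveI2[of _ _ 1]) simp
    have "\<exists>z. f z \<noteq> 0"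
    proof (rule ccontr)
      assume "\<not> ?thesis"
      then show False using Vf V by simp
    qed
    then obtain z where "0 < f z"
      using log_concave_fun_nonneg[OF f] by (metis less_eq_real_def)
    then have sup: "0 < (SUP x. f x)"
      using bdd by (meson UNIV_I cSUP_upper less_le_trans)
    then have "(SUP x. f x) / 2 < (SUP x. f x)" by simp
    then obtain z where "z \<in> range f" "(SUP x. f x) / 2 < z"
      by (rule less_cSupE) auto
    then obtain x0 where "(SUP x. f x) / 2 < f x0" by auto
    moreover have "f x \<le> (SUP x. f x)" for x using bdd by (intro cSUP_upper) auto
    moreover have "f x \<le> 2 * f x0" for x using calculation(1) calculation(2)[of x] by linarith
    ultimately show ?thesis using sup by (intro that[of x0]) auto
  qed
  define m where "m = 2 * f x0"
  have m: "0 < m" "\<And>x. f x \<le> m" using x0 by (auto simp: m_def)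
  \<comment> \<open>This is the exponent \<open>2 * s + 2 * n + 2\<close> at \<open>s = 1\<close>,
    so \<open>K\<close> carries at least half of the mass \<open>V\<close>. The exponent
    \<open>u\<close> of \<open>L\<close> is the same expression at the given
    \<open>s\<close>.\<close>
  define v where "v = 2 * n + 4"
  define u where "u = 2 * s + 2 * n + 2"
  define K where "K = {x. m * exp (-v) \<le> f x}"
  define L where "L = {x. m * exp (-u) \<le> f x}"
  have K: "compact K" "convex K"
    using compact_superlevel_ball_mass[OF pM sM, of "m * exp (-v)" \<rho>]
      convex_superlevel_log_concave[OF f, of "m * exp (-v)"] m
    by (auto simp: K_def f_def)
  have [measurable]: "K \<in> sets borel" "L \<in> sets borel" by (simp_all add: K_def L_def)
  have "ennreal ((1 - exp (-1)) * V) \<le> (\<integral>\<^sup>+x. ennreal (f x) * indicator K x \<partial>lborel)"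
    using nn_integral_superlevel_ge[OF f f_meas x0(1) Vf, of 1] V
    by (simp add: K_def m_def v_def n_def algebra_simps)
  moreover have "V / 2 \<le> (1 - exp (-1)) * V"
  proof -
    have "2 \<le> exp (1::real)" using exp_ge_add_one_self[of 1] by simp
    then have "1 / 2 \<le> 1 - exp (-1::real)" by (simp add: exp_minus field_simps)
    then show ?thesis using V mult_right_mono[of "1/2" _ V] by simp
  qed
  ultimately have Kge: "ennreal (V / 2) \<le> (\<integral>\<^sup>+x. ennreal (f x) * indicator K x \<partial>lborel)"
    by (meson ennreal_leI order_trans)
  have "(\<integral>\<^sup>+x. ennreal (f x) * indicator K x \<partial>lborel) \<le> ennreal V"
    unfolding Vf[symmetric] by (intro nn_integral_mono) (auto simp: indicator_def)
  then obtain i where i: "(\<integral>\<^sup>+x. ennreal (f x) * indicator K x \<partial>lborel) = ennreal i" "0 \<le> i"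
    by (metis ennreal_cases ennreal_neq_top neq_top_trans)
  have iV: "V / 2 \<le> i" using Kge V i by simp
  obtain b where b: "b \<in> K" and bexp: "\<And>\<zeta>. ennreal (exp (\<zeta> \<bullet> b)) * ennreal i
      \<le> (\<integral>\<^sup>+w. ennreal (exp (\<zeta> \<bullet> w)) * (ennreal (f w) * indicator K w) \<partial>lborel)"
    using weighted_exp_barycentre_le[OF log_concave_fun_nonneg[OF f] f_meas K i(1)] iV V
    by (metis half_gt_zero less_le_trans)
  \<comment> \<open>With this ratio the Jacobian \<open>e ^ DIM('a)\<close> adds
    \<open>n * s\<close> to the level \<open>c\<close>, and the mass lost by contracting is of the
    same order as the mass outside \<open>L\<close>.\<close>
  define e where "e = exp (-s)"
  have e: "0 < e" "e < 1" using s by (auto simp: e_def)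

  have upper: "(\<integral>\<^sup>+x. ennreal (exp (\<xi> \<bullet> x)) * ennreal (f x) \<partial>lborel)
      \<le> ennreal (V * exp (\<rho> * norm \<xi>)) * (\<integral>\<^sup>+z. ennreal (exp (\<xi> \<bullet> z)) \<partial>M)" for \<xi>
  proof -
    have "(\<integral>\<^sup>+x. ennreal (exp (\<xi> \<bullet> x)) * indicator (cball w \<rho>) x \<partial>lborel)
        \<le> ennreal (V * exp (\<rho> * norm \<xi>)) * ennreal (exp (\<xi> \<bullet> w))" for w
    proof -
      have "\<xi> \<bullet> x \<le> \<rho> * norm \<xi> + \<xi> \<bullet> w" if "x \<in> cball w \<rho>" for x
      proof -
        have "\<xi> \<bullet> (x - w) \<le> norm \<xi> * norm (x - w)" by (rule norm_cauchy_schwarz)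
        also have "\<dots> \<le> norm \<xi> * \<rho>"
          using that by (intro mult_left_mono) (auto simp: dist_norm norm_minus_commute)
        finally show ?thesis by (simp add: inner_diff_right algebra_simps)
      qed
      then have "(\<integral>\<^sup>+x. ennreal (exp (\<xi> \<bullet> x)) * indicator (cball w \<rho>) x \<partial>lborel)
          \<le> (\<integral>\<^sup>+x. ennreal (exp (\<rho> * norm \<xi> + \<xi> \<bullet> w)) * indicator (cball w \<rho>) x \<partial>lborel)"
        by (intro nn_integral_mono) (auto simp: indicator_def intro!: ennreal_leI)
      also have "\<dots> = ennreal (exp (\<rho> * norm \<xi> + \<xi> \<bullet> w)) * ennreal V"
        by (simp add: nn_integral_cmult_indicator vol)
      finally show ?thesis
        using V by (simp add: exp_add mult_ac flip: ennreal_mult')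
    qed
    then have "(\<integral>\<^sup>+x. ennreal (exp (\<xi> \<bullet> x)) * ennreal (f x) \<partial>lborel)
        \<le> (\<integral>\<^sup>+w. ennreal (V * exp (\<rho> * norm \<xi>)) * ennreal (exp (\<xi> \<bullet> w)) \<partial>M)"
      by (subst fint) (auto intro: nn_integral_mono)
    then show ?thesis by (simp add: nn_integral_cmult)
  qed

  let ?S = "\<lambda>x. (1 / (1 - e)) *\<^sub>R (x - e *\<^sub>R b)"
  have in_T: "w \<in> ?T" if x: "?S x \<in> L" and w: "x \<in> cball w \<rho>" for x w
  proof -
    have "ennreal (exp (w \<bullet> \<xi> - c - 2 * \<rho> * norm \<xi>)) \<le> (\<integral>\<^sup>+z. ennreal (exp (\<xi> \<bullet> z)) \<partial>M)"
      (is "_ \<le> ?E") for \<xi>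
    proof -
      let ?q = "V * exp (\<rho> * norm \<xi>)"
      have x_eq: "x = (1 - e) *\<^sub>R ?S x + e *\<^sub>R b" using e by simp
      have "ennreal (e ^ DIM('a) * exp (-u) * exp (\<xi> \<bullet> x)) * ennreal i
          \<le> (\<integral>\<^sup>+x. ennreal (exp (\<xi> \<bullet> x)) * ennreal (f x) \<partial>lborel)"
        using nn_integral_exp_log_concave_ge[OF f f_meas e m _ _ _ bexp, of u "?S x" \<xi>] x s x_eq
        by (simp add: L_def u_def n_def)
      also have "\<dots> \<le> ennreal ?q * ?E" by (rule upper)
      finally have *: "ennreal (e ^ DIM('a) * exp (-u) * exp (\<xi> \<bullet> x)) * ennreal i \<le> ennreal ?q * ?E" .
      \<comment> \<open>The factor \<open>?q\<close> comes from \<open>upper\<close> and is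
        cancelled at the end. It uses up one of the two terms \<open>\<rho> * norm \<xi>\<close>;
        the other bounds \<open>\<xi> \<bullet> (w - x)\<close>.\<close>
      have "exp (w \<bullet> \<xi> - c - 2 * \<rho> * norm \<xi>) * ?q
          = exp (w \<bullet> \<xi> - \<rho> * norm \<xi>) * (exp (-c) * V)"
        by (simp add: mult_ac flip: exp_add)
      also have "\<dots> \<le> exp (\<xi> \<bullet> x) * (exp (-c) * V)"
      proof -
        have "\<xi> \<bullet> (w - x) \<le> norm \<xi> * norm (w - x)" by (rule norm_cauchy_schwarz)
        also have "\<dots> \<le> norm \<xi> * \<rho>"
          using w by (intro mult_left_mono) (auto simp: dist_norm)
        finally show ?thesis
          using V by (intro mult_right_mono) (auto simp: inner_diff_right inner_commute algebra_simps)
      qed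
      also have "\<dots> \<le> exp (\<xi> \<bullet> x) * (e ^ DIM('a) * exp (-u) * i)"
      proof (intro mult_left_mono)
        \<comment> \<open>The level is \<open>c = n * s + u + 1\<close>; the extra 1 pays for
          \<open>V \<le> 2 * i\<close>.\<close>
        have "e ^ DIM('a) * exp (-u) = exp (-c) * exp 1"
          by (simp add: e_def c_def u_def n_def algebra_simps flip: exp_of_nat_mult exp_add)
        moreover have "exp (-c) * V \<le> exp (-c) * (exp 1 * i)"
        proof (intro mult_left_mono)
          have "2 \<le> exp (1::real)" using exp_ge_add_one_self[of 1] by simp
          then have "2 * i \<le> exp 1 * i" using i by (intro mult_right_mono) auto
          then show "V \<le> exp 1 * i" using iV by simp
        qed simp
        ultimately show "exp (-c) * V \<le> e ^ DIM('a) * exp (-u) * i" by simp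
      qed simp
      finally have "ennreal (exp (w \<bullet> \<xi> - c - 2 * \<rho> * norm \<xi>) * ?q)
          \<le> ennreal (e ^ DIM('a) * exp (-u) * exp (\<xi> \<bullet> x) * i)"
        by (intro ennreal_leI) (simp add: mult_ac)
      also have "\<dots> \<le> ennreal ?q * ?E" using * i by (simp add: ennreal_mult'')
      finally have "ennreal ?q * ennreal (exp (w \<bullet> \<xi> - c - 2 * \<rho> * norm \<xi>)) \<le> ennreal ?q * ?E"
        using V by (simp add: ennreal_mult' mult_ac)
      then show ?thesis using V by (subst (asm) ennreal_mult_le_mult_iff) auto
    qed
    then show ?thesis by (simp add: relaxed_cramer_sublevel_def c_def)
  qed
  have T_sets: "?T \<in> sets M" by (simp add: sM closed_relaxed_cramer_sublevel)
  have "ennreal ((1 - e) ^ DIM('a) * exp (-v * e) * ((1 - e) * V))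
      = ennreal ((1 - e) ^ DIM('a) * exp (-v * e)) * ennreal ((1 - e) * V)"
    using e V by (intro ennreal_mult) auto
  also have "\<dots> \<le> ennreal ((1 - e) ^ DIM('a) * exp (-v * e)) *
      (\<integral>\<^sup>+x. ennreal (f x) * indicator L x \<partial>lborel)"
    using nn_integral_superlevel_ge[OF f f_meas x0(1) Vf, of s] V
    by (intro mult_left_mono) (simp_all add: L_def m_def u_def e_def n_def)
  also have "\<dots> \<le> (\<integral>\<^sup>+x. ennreal (f x) * indicator L (?S x) \<partial>lborel)"
    using b by (intro nn_integral_contracted_superlevel_ge[OF f f_meas e m(2)]) (auto simp: K_def)
  \<comment> \<open>Tonelli turns the integral against \<open>f\<close> into one over pairs; by
    \<open>in_T\<close> the condition on \<open>x\<close> can then be replaced by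
    \<open>w \<in> ?T\<close>.\<close>
  also have "\<dots> = (\<integral>\<^sup>+w. (\<integral>\<^sup>+x. indicator L (?S x) * indicator (cball w \<rho>) x \<partial>lborel) \<partial>M)"
    by (subst fint[symmetric]) (auto simp: mult.commute)
  also have "\<dots> \<le> (\<integral>\<^sup>+w. (\<integral>\<^sup>+x. indicator ?T w * indicator (cball w \<rho>) x \<partial>lborel) \<partial>M)"
    using in_T by (intro nn_integral_mono) (auto simp: indicator_def)
  also have "\<dots> = (\<integral>\<^sup>+w. ennreal V * indicator ?T w \<partial>M)"
  proof (rule nn_integral_cong)
    fix w
    show "(\<integral>\<^sup>+x. indicator ?T w * indicator (cball w \<rho>) x \<partial>lborel) = ennreal V * indicator ?T w"
      by (cases "w \<in> ?T") (simp_all add: vol)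
  qed
  also have "\<dots> = ennreal (measure M ?T * V)"
    unfolding nn_integral_cmult_indicator[OF T_sets] emeasure_eq_measure
    using V by (subst mult.commute) (simp add: ennreal_mult)
  finally have "(1 - e) ^ DIM('a) * exp (-v * e) * ((1 - e) * V) \<le> measure M ?T * V"
    using V by (subst (asm) ennreal_le_iff) auto
  then have main: "(1 - e) ^ DIM('a) * exp (-v * e) * (1 - e) \<le> measure M ?T"
    using V by (simp flip: mult.assoc)
  \<comment> \<open>Used twice to add up the three losses: \<open>n * e\<close> from the Jacobian,
    \<open>v * e\<close> from log-concavity and \<open>e\<close> from the complement of
    \<open>L\<close>. Since \<open>v = 2 * n + 4\<close>, they total
    \<open>(3 * n + 5) * e\<close>.\<close>
  have prod: "1 - (p + q) \<le> P * Q"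
    if "1 - p \<le> P" "1 - q \<le> Q" "0 \<le> P" "P \<le> 1" "0 \<le> Q" "Q \<le> 1" for p q P Q :: real
  proof -
    have "0 \<le> (1 - P) * (1 - Q)" using that by simp
    then show ?thesis using that by (simp add: algebra_simps)
  qed
  have n0: "0 \<le> v" by (simp add: v_def n_def)
  have "1 - (n * e + v * e) \<le> (1 - e) ^ DIM('a) * exp (-v * e)"
  proof (rule prod)
    show "1 - n * e \<le> (1 - e) ^ DIM('a)"
      using Bernoulli_inequality[of "-e" "DIM('a)"] e by (simp add: n_def)
    show "1 - v * e \<le> exp (-v * e)" using exp_ge_add_one_self[of "-v * e"] by simp
  qed (use e n0 in \<open>auto simp: power_le_one\<close>)
  then have "1 - (n * e + v * e + e) \<le> (1 - e) ^ DIM('a) * exp (-v * e) * (1 - e)"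
    using e n0 by - (rule prod, auto simp: power_le_one mult_le_one)
  with main show ?thesis by (simp add: v_def e_def algebra_simps)
qed

text \<open>The preceding bound does not depend on \<open>\<rho>\<close>, so continuity from above
  along slacks \<open>1 / Suc k\<close> carries it to slack 0; then pass to complements.\<close>

lemma measure_cramer_greater_le:
  fixes M :: "'a::euclidean_space measure"
  assumes M: "log_concave_measure M" and s: "0 < s"
  defines "n \<equiv> real DIM('a)"
  shows "measure M {x. ereal (n * s + 2 * s + 2 * n + 3) < cramer M x} \<le> (3 * n + 5) * exp (-s)"
proof -
  interpret prob_space M using M by (simp add: log_concave_measure_def)
  have sM: "sets M = sets borel" using M by (simp add: log_concave_measure_def)
  let ?c = "n * s + 2 * s + 2 * n + 3"
  let ?T = "relaxed_cramer_sublevel M ?c"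
  have meas: "?T \<delta> \<in> sets M" for \<delta>
    by (simp add: sM closed_relaxed_cramer_sublevel)
  have "(\<lambda>k. measure M (?T (1 / Suc k))) \<longlonglongrightarrow> measure M (\<Inter>k. ?T (1 / Suc k))"
  proof (rule finite_Lim_measure_decseq)
    show "decseq (\<lambda>k. ?T (1 / Suc k))"
      unfolding decseq_def by (intro allI impI relaxed_cramer_sublevel_mono) (simp add: frac_le)
  qed (use meas in auto)
  moreover have "1 - (3 * n + 5) * exp (-s) \<le> measure M (?T (1 / Suc k))" for k
  proof -
    have half: "2 * (d / 2) = d" for d :: real by simp
    show ?thesis
      using measure_relaxed_cramer_sublevel_ge[OF M _ s, of "1 / Suc k / 2"]
      unfolding n_def half by simp
  qed
  ultimately have "1 - (3 * n + 5) * exp (-s) \<le> measure M (?T 0)"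
    unfolding INT_relaxed_cramer_sublevel by (intro LIMSEQ_le_const) auto
  moreover have "{x. ereal ?c < cramer M x} = space M - ?T 0"
    using cramer_le_iff[of M _ ?c] sets_eq_imp_space_eq[OF sM] by (auto simp: not_le[symmetric])
  ultimately show ?thesis using prob_compl[OF meas, of 0] by simp
qed

subsection \<open>The exponential moment\<close>

lemma exp_ereal_le:
  assumes "0 < r" "y \<le> ereal c"
  shows "exp_ereal (y / ereal r) \<le> ennreal (exp (c / r))"
  using assms by (cases y) (auto simp: exp_ereal_def divide_right_mono intro!: ennreal_leI)

text \<open>Discretisation with step \<open>q\<close>: a finite \<open>y\<close> above the first
  threshold lies in one half-open interval, and the term of that interval alone dominates. Pointwise
  summation prepares for integrating term by term against tail bounds.\<close>

lemma exp_ereal_le_geometric_sum: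
  fixes y :: ereal and q d r :: real and k0 :: nat
  assumes r: "0 < r" and q: "0 < q"
  shows "exp_ereal (y / ereal r) \<le> ennreal (exp ((q * k0 + d) / r)) +
    (\<Sum>k. ennreal (exp ((q * (real (k + k0) + 1) + d) / r)) *
      (if ereal (q * real (k + k0) + d) < y then 1 else 0))"
    (is "_ \<le> _ + (\<Sum>k. ?g k)")
proof (cases "y \<le> ereal (q * k0 + d)")
  case True
  then show ?thesis using exp_ereal_le[OF r True] by (auto intro: order_trans)
next
  case False
  have "exp_ereal (y / ereal r) \<le> (\<Sum>k. ?g k)"
  proof (cases y)
    case (real z)
    define w where "w = (z - d) / q"
    have z: "z = q * w + d" using q by (simp add: w_def)
    have "real k0 < w" using False q by (simp add: real z)
    then have c: "int k0 < \<lceil>w\<rceil>" by (simp add: less_ceiling_iff)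
    \<comment> \<open>Ceiling minus one makes the lower bound on \<open>w\<close> strict, as the
      indicator demands, and the upper bound non-strict.\<close>
    define k where "k = nat (\<lceil>w\<rceil> - 1 - int k0)"
    have k: "real k + real k0 = of_int \<lceil>w\<rceil> - 1" using c by (simp add: k_def)
    have w: "real k + real k0 < w" "w \<le> real k + real k0 + 1" using k by linarith+
    have "exp_ereal (y / ereal r) \<le> ennreal (exp ((q * (real (k + k0) + 1) + d) / r))"
      using w(2) q by (intro exp_ereal_le r) (simp add: real z)
    also have "\<dots> = ?g k" using w(1) q by (simp add: real z)
    also have "?g k \<le> (\<Sum>k. ?g k)"
      using sum_le_suminf[of ?g "{k}"] by simp
    finally show ?thesis .
  next
    case PInf
    \<comment> \<open>All indicators equal 1 and every term is at least \<open>exp (d / r)\<close>,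
      so the series diverges.\<close>
    have "(\<Sum>k. ?g k) = \<top>"
    proof (rule ccontr)
      let ?c = "ennreal (exp (d / r))"
      assume "(\<Sum>k. ?g k) \<noteq> \<top>"
      then obtain S where S: "(\<Sum>k. ?g k) = ennreal S" "0 \<le> S"
        by (cases "\<Sum>k. ?g k" rule: ennreal_cases) auto
      obtain N :: nat where N: "S < real N * exp (d / r)"
        using reals_Archimedean3[of "exp (d / r)"] by auto
      have "ennreal (real N * exp (d / r)) = (\<Sum>k<N. ?c)"
        by (simp add: ennreal_of_nat_eq_real_of_nat ennreal_mult')
      also have "\<dots> \<le> (\<Sum>k<N. ?g k)"
        using q r by (intro sum_mono) (auto simp: PInf divide_right_mono intro!: ennreal_leI)
      also have "\<dots> \<le> (\<Sum>k. ?g k)" by (intro sum_le_suminf) auto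
      also have "\<dots> < ennreal (real N * exp (d / r))"
        unfolding S(1) using S(2) N by (intro ennreal_lessI) auto
      finally show False by simp
    qed
    then show ?thesis by simp
  qed (use False in auto)
  then show ?thesis by (simp add: add_increasing)
qed

text \<open>Below index \<open>k0\<close> the integrand is bounded trivially; from \<open>k0\<close>
  on, the tail bounds give a geometric series of ratio \<open>exp (q / r - 1)\<close>, which
  converges because \<open>q < r\<close>.\<close>

lemma (in prob_space) nn_integral_exp_ereal_le:
  fixes Y :: "'a \<Rightarrow> ereal" and k0 :: nat
  assumes r: "0 < r" and q: "0 < q" "q < r"
    and meas: "\<And>k. {x \<in> space M. ereal (q * real k + d) < Y x} \<in> sets M"
    and tail: "\<And>k. k0 \<le> k \<Longrightarrow> prob {x \<in> space M. ereal (q * real k + d) < Y x} \<le> B * exp (- real k)"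
  shows "(\<integral>\<^sup>+x. exp_ereal (Y x / ereal r) \<partial>M) \<le> ennreal (exp ((q * k0 + d) / r) *
    (1 + B * exp (q / r - k0) / (1 - exp (q / r - 1))))"
proof -
  define a where "a = q / r"
  have a: "a < 1" using r q by (simp add: a_def)
  let ?E = "\<lambda>k. {x \<in> space M. ereal (q * real k + d) < Y x}"
  let ?t = "exp ((q * k0 + d) / r)"
  have "0 \<le> B * exp (- real k0)" using tail[of k0] measure_nonneg[of M "?E k0"] by linarith
  then have B: "0 \<le> B" by (simp add: zero_le_mult_iff)
  have "(\<integral>\<^sup>+x. exp_ereal (Y x / ereal r) \<partial>M) \<le> (\<integral>\<^sup>+x. ennreal ?t +
      (\<Sum>k. ennreal (exp ((q * (real (k + k0) + 1) + d) / r)) * indicator (?E (k + k0)) x) \<partial>M)"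
  proof (rule nn_integral_mono)
    fix x assume x: "x \<in> space M"
    then have "(if ereal (q * real (k + k0) + d) < Y x then 1 else 0) = (indicator (?E (k + k0)) x :: ennreal)" for k
      by (simp add: indicator_def)
    then show "exp_ereal (Y x / ereal r) \<le> ennreal ?t +
      (\<Sum>k. ennreal (exp ((q * (real (k + k0) + 1) + d) / r)) * indicator (?E (k + k0)) x)"
      using exp_ereal_le_geometric_sum[OF r q(1), of "Y x" k0 d] by (simp only:)
  qed
  also have "\<dots> = ennreal ?t +
      (\<Sum>k. ennreal (exp ((q * (real (k + k0) + 1) + d) / r)) * emeasure M (?E (k + k0)))"
    using meas by (simp add: nn_integral_add nn_integral_suminf nn_integral_cmult_indicator emeasure_space_1
        del: of_nat_add)
  also have "\<dots> \<le> ennreal ?t + (\<Sum>k. ennreal (?t * (B * exp (a - k0)) * exp (a - 1) ^ k))"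
  proof (intro add_left_mono suminf_le)
    fix k
    have "exp ((q * (real (k + k0) + 1) + d) / r) * prob (?E (k + k0))
        \<le> exp ((q * (real (k + k0) + 1) + d) / r) * (B * exp (- real (k + k0)))"
      using tail[of "k + k0"] by (intro mult_left_mono) auto
    also have "\<dots> = B * (exp ((q * (real (k + k0) + 1) + d) / r) * exp (- real (k + k0)))" by simp
    also have "exp ((q * (real (k + k0) + 1) + d) / r) * exp (- real (k + k0)) = ?t * exp (a - k0) * exp (a - 1) ^ k"
      using r by (simp add: a_def field_simps flip: exp_of_nat_mult exp_add)
    finally show "ennreal (exp ((q * (real (k + k0) + 1) + d) / r)) * emeasure M (?E (k + k0))
        \<le> ennreal (?t * (B * exp (a - k0)) * exp (a - 1) ^ k)"
      by (simp add: emeasure_eq_measure mult_ac ennreal_leI flip: ennreal_mult'')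
  qed auto
  also have "(\<Sum>k. ennreal (?t * (B * exp (a - k0)) * exp (a - 1) ^ k))
      = ennreal (?t * (B * exp (a - k0)) * (1 / (1 - exp (a - 1))))"
    using a B by (intro suminf_ennreal_eq sums_mult geometric_sums) auto
  also have "ennreal ?t + \<dots> = ennreal (?t + ?t * (B * exp (a - k0)) * (1 / (1 - exp (a - 1))))"
    using a B by (intro ennreal_plus[symmetric]) auto
  finally show ?thesis by (simp add: a_def algebra_simps)
qed

text \<open>The choice \<open>k0 \<ge> ln n + 4\<close> cancels the prefactor \<open>n\<close> and
  makes the second factor at most \<open>3 / 2\<close>. As \<open>2 * n / r\<close> is at most
  \<open>1 / 32\<close>, also after multiplication by \<open>ln n\<close>, the exponent of the first
  factor is at most \<open>1 / 32 + 7 / 32 = 1 / 4\<close>, and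
  \<open>exp (1 / 4) \<le> 4 / 3\<close>.\<close>

lemma exp_moment_constant_le_2:
  fixes n :: real
  assumes n: "2 \<le> n"
  defines "r \<equiv> 32 / ln 2 * n * (n * ln n)" and "k0 \<equiv> nat \<lceil>ln n + 4\<rceil>"
  shows "exp ((2 * n * real k0 + 4 * n) / r) *
    (1 + 6 * n * exp (2 * n / r - real k0) / (1 - exp (2 * n / r - 1))) \<le> 2"
proof -
  define a where "a = 2 * n / r"
  have ln_n: "0 < ln n" using n by simp
  have k0: "ln n + 4 \<le> real k0" "real k0 \<le> ln n + 5"
    using ln_n by (simp_all add: k0_def real_nat_ceiling_ge) linarith
  have a_eq: "a = ln 2 / (16 * n * ln n)" using n ln_n by (simp add: a_def r_def field_simps)
  have a0: "0 < a" unfolding a_eq using n ln_n by simp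
  have a32: "a \<le> 1 / 32"
  proof -
    have "2 * ln 2 \<le> n * ln n" using n by (intro mult_mono) auto
    then show ?thesis unfolding a_eq using n ln_n by (simp add: field_simps)
  qed
  have aln: "a * ln n \<le> 1 / 32"
  proof -
    have "a * ln n = ln 2 / (16 * n)" using n ln_n by (simp add: a_eq)
    also have "\<dots> \<le> 1 / (16 * 2)" using n ln_2_less_1 by (intro frac_le) auto
    finally show ?thesis by simp
  qed
  have e1: "5 / 2 \<le> exp (1::real)" using exp_lower_Taylor_quadratic[of 1] by simp
  have inv_exp: "exp x \<le> 1 / (1 - x)" if "x < 1" for x :: real
    using exp_ge_add_one_self[of "-x"] that by (simp add: exp_minus field_simps)
  have ea: "exp a \<le> 32 / 31"
    using inv_exp[of a] a32 frac_le[of 1 1 "31/32" "1 - a"] by simp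
  have "exp (a - 1) = exp a / exp 1" by (simp add: exp_diff)
  also have "\<dots> \<le> (32 / 31) / (5 / 2)" using ea e1 by (intro frac_le) auto
  finally have ea1: "exp (a - 1) \<le> 64 / 155" by simp
  have "n * exp (a - real k0) \<le> n * exp (a - (ln n + 4))"
    using n k0 by (intro mult_left_mono) auto
  also have "\<dots> = exp a / exp 1 ^ 4"
    using n by (simp add: exp_diff exp_add flip: exp_of_nat_mult)
  also have "\<dots> \<le> (32 / 31) / (5 / 2) ^ 4" using ea e1 by (intro frac_le power_mono) auto
  finally have nk: "6 * n * exp (a - real k0) \<le> 6 * ((32 / 31) / (5 / 2) ^ 4)" by simp
  have "6 * n * exp (a - real k0) / (1 - exp (a - 1)) \<le> (6 * ((32 / 31) / (5 / 2) ^ 4)) / (91 / 155)"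
    using nk ea1 n by (intro frac_le) auto
  also have "\<dots> \<le> 1 / 2" by (simp add: eval_nat_numeral)
  finally have second: "1 + 6 * n * exp (a - real k0) / (1 - exp (a - 1)) \<le> 3 / 2" by simp
  have "(2 * n * real k0 + 4 * n) / r = a * (real k0 + 2)"
    by (simp add: a_def add_divide_distrib algebra_simps)
  also have "\<dots> \<le> a * (ln n + 7)" using a0 k0 by (intro mult_left_mono) auto
  also have "\<dots> \<le> 1 / 4" using aln a32 by (simp add: algebra_simps)
  finally have "exp ((2 * n * real k0 + 4 * n) / r) \<le> exp (1 / 4)" by simp
  also have "\<dots> \<le> 4 / 3" using inv_exp[of "1/4"] by simp
  finally have "exp ((2 * n * real k0 + 4 * n) / r) *
      (1 + 6 * n * exp (a - real k0) / (1 - exp (a - 1))) \<le> 4 / 3 * (3 / 2)"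
    using second n ea1 a32 by (intro mult_mono add_nonneg_nonneg divide_nonneg_nonneg) auto
  then show ?thesis by (simp add: a_def)
qed

text \<open>The radius \<open>r0_dim\<close> is itself admissible in the infimum: the tail bound at
  integers \<open>s = k\<close> feeds the moment estimate with \<open>q = 2 * n\<close>,
  \<open>d = 4 * n\<close> and \<open>B = 6 * n\<close>. Dimension at least 2 keeps
  \<open>r0_dim\<close> positive, since \<open>ln 1 = 0\<close>.\<close>

lemma cramer_psi1_norm_le:
  fixes M :: "'a::euclidean_space measure"
  assumes M: "log_concave_measure M" and dim: "2 \<le> DIM('a)"
  shows "cramer_psi1_norm M \<le> ereal (r0_dim DIM('a))"
proof -
  interpret prob_space M using M by (simp add: log_concave_measure_def)
  have sM: "sets M = sets borel" using M by (simp add: log_concave_measure_def)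
  define n where "n = real DIM('a)"
  define r where "r = r0_dim DIM('a)"
  define k0 where "k0 = nat \<lceil>ln n + 4\<rceil>"
  have n: "2 \<le> n" using dim by (simp add: n_def)
  have r_eq: "r = 32 / ln 2 * n * (n * ln n)" by (simp add: r_def r0_dim_def t_dim_def n_def)
  have r: "2 * n < r"
  proof -
    have "2 * ln 2 \<le> n * ln n" using n by (intro mult_mono) auto
    then have "2 \<le> n * ln n / ln 2" by (simp add: field_simps)
    then have "32 * n * 2 \<le> 32 * n * (n * ln n / ln 2)" using n by (intro mult_left_mono) auto
    then show ?thesis using n by (simp add: r_eq)
  qed
  \<comment> \<open>The tail bound is available only for \<open>s > 0\<close>.\<close>
  have k0: "0 < k0"
  proof -
    have "0 < ln n + 4" using n by (intro add_nonneg_pos) auto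
    then show ?thesis unfolding k0_def zero_less_nat_eq zero_less_ceiling .
  qed
  have meas: "{x \<in> space M. ereal c < cramer M x} \<in> sets M" for c
  proof -
    have "{x \<in> space M. ereal c < cramer M x} = space M - relaxed_cramer_sublevel M c 0"
      using cramer_le_iff[of M _ c] by (auto simp: not_le[symmetric])
    moreover have "relaxed_cramer_sublevel M c 0 \<in> sets M"
      by (simp add: sM closed_relaxed_cramer_sublevel)
    ultimately show ?thesis by auto
  qed
  have tail: "prob {x \<in> space M. ereal (2 * n * real k + 4 * n) < cramer M x} \<le> 6 * n * exp (- real k)"
    if "k0 \<le> k" for k
  proof -
    have space: "space M = UNIV" using sets_eq_imp_space_eq[OF sM] by simp
    \<comment> \<open>From \<open>2 \<le> n\<close>: \<open>2 * real k\<close> is absorbed in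
      \<open>n * real k\<close>, and \<open>3\<close> in \<open>2 * n\<close>.\<close>
    have "n * real k + 2 * real k + 2 * n + 3 \<le> 2 * n * real k + 4 * n"
      using n mult_right_mono[OF n, of "real k"] by simp
    then have "prob {x \<in> space M. ereal (2 * n * real k + 4 * n) < cramer M x}
        \<le> prob {x \<in> space M. ereal (n * real k + 2 * real k + 2 * n + 3) < cramer M x}"
      by (intro finite_measure_mono meas) (auto elim: le_less_trans[rotated])
    also have "\<dots> \<le> (3 * n + 5) * exp (- real k)"
      using measure_cramer_greater_le[OF M, of "real k"] that k0 by (simp add: n_def space)
    also have "\<dots> \<le> 6 * n * exp (- real k)" using n by (intro mult_right_mono) auto
    finally show ?thesis .
  qed
  have "(\<integral>\<^sup>+x. exp_ereal (cramer M x / ereal r) \<partial>M)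
      \<le> ennreal (exp ((2 * n * real k0 + 4 * n) / r) *
          (1 + 6 * n * exp (2 * n / r - real k0) / (1 - exp (2 * n / r - 1))))"
    using n r by (intro nn_integral_exp_ereal_le meas tail) auto
  also have "\<dots> \<le> ennreal 2"
    unfolding r_eq k0_def by (intro ennreal_leI exp_moment_constant_le_2 n)
  finally have "(\<integral>\<^sup>+x. exp_ereal (cramer M x / ereal r) \<partial>M) \<le> 2" by simp
  then show ?thesis
    unfolding cramer_psi1_norm_def r_def[symmetric] using n r by (intro Inf_lower) auto
qed

section \<open>The norm bound and the order of magnitude of its radius\<close>

theorem mainTheorem7:
  fixes M :: "(real ^ 'n) measure"
  assumes "CARD('n) \<ge> 2"
    and "log_concave_measure M"
    and "centered M"
  shows "cramer_psi1_norm M \<le> ereal (r0_dim CARD('n)) \<and>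
    (\<exists>c1>0. \<exists>c2>0. \<forall>m::nat. m \<ge> 1 \<longrightarrow>
       c1 * r0_dim m \<le> (real m)\<^sup>2 * ln (real m) \<and>
       (real m)\<^sup>2 * ln (real m) \<le> c2 * r0_dim m) \<and>
    cramer_psi1_norm M \<le> ereal (32 / ln 2 * (real CARD('n))\<^sup>2 * ln (real CARD('n)))"
proof (intro conjI)
  show bound: "cramer_psi1_norm M \<le> ereal (r0_dim CARD('n))"
    using cramer_psi1_norm_le[OF assms(2)] assms(1) by simp
  show "cramer_psi1_norm M \<le> ereal (32 / ln 2 * (real CARD('n))\<^sup>2 * ln (real CARD('n)))"
    using bound by (simp add: r0_dim_def t_dim_def power2_eq_square mult.assoc)
  \<comment> \<open>With \<open>c1 = c2 = ln 2 / 32\<close> both inequalities are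
    equalities.\<close>
  show "\<exists>c1>0. \<exists>c2>0. \<forall>m::nat. m \<ge> 1 \<longrightarrow>
       c1 * r0_dim m \<le> (real m)\<^sup>2 * ln (real m) \<and>
       (real m)\<^sup>2 * ln (real m) \<le> c2 * r0_dim m"
    by (intro exI[of _ "ln 2 / 32"] conjI)
      (simp_all add: r0_dim_def t_dim_def power2_eq_square mult.assoc)
qed

end
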